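(* Let $A\in\mathbb{R}^{N\times 2}$, $\boldsymbol{b}\in\mathbb{R}^{N}$, and let $\mathcal C=\{\boldsymbol{p}\in\mathbb{R}^2 \mid A\boldsymbol{p}\le \boldsymbol{b}\}$ be a convex polygon. Let $\boldsymbol{q}\in\mathbb{R}^2$ be a point. Then $$\{\boldsymbol{q}\}\cap\mathcal C=\emptyset \iff \exists\, \boldsymbol{\lambda}\in\mathbb{R}^N,\ \boldsymbol{\lambda}\ge \boldsymbol{0}:\ (A\boldsymbol{q}-\boldsymbol{b})^{\top}\boldsymbol{\lambda}>0 .$$
   Context: Vector inequalities such as $A\boldsymbol{p}\le\boldsymbol{b}$ and $\boldsymbol{\lambda}\ge\boldsymbol{0}$ are understood componentwise. *)

theory Defs
  imports "HOL-Analysis.Analysis"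
begin

end

theory Submission
  imports Defs
begin

text \<open>The entries of \<open>A *v q - b\<close> measure by how much \<open>q\<close> violates
  each constraint, so \<open>q\<close> lies outside \<open>C\<close> iff some entry is positive. A
  nonnegative weighting of the entries can have a positive total iff one of them is positive: put
  all the weight on it.\<close>

theorem proposition1:
  fixes A :: "real ^ 2 ^ 'n" and b :: "real ^ 'n"
    and C :: "(real ^ 2) set" and q :: "real ^ 2"
  assumes "C = {p. A *v p \<le> b}"
    and "polytope C"
  shows "{q} \<inter> C = {} \<longleftrightarrow> (\<exists>l :: real ^ 'n. l \<ge> 0 \<and> (A *v q - b) \<bullet> l > 0)"
proof
  assume "{q} \<inter> C = {}"
  with assms(1) obtain i where i: "(A *v q - b) $ i > 0"
    by (auto simp: less_eq_vec_def not_le)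
  \<comment> \<open>Unit weight on the violated row \<open>i\<close> makes the inner product equal
    to that row's violation.\<close>
  have "axis i 1 \<ge> (0 :: real ^ 'n)"
    by (simp add: less_eq_vec_def axis_def)
  with i show "\<exists>l :: real ^ 'n. l \<ge> 0 \<and> (A *v q - b) \<bullet> l > 0"
    by (intro exI[of _ "axis i 1"]) (simp add: inner_axis)
next
  assume "\<exists>l :: real ^ 'n. l \<ge> 0 \<and> (A *v q - b) \<bullet> l > 0"
  then obtain l :: "real ^ 'n" where l: "l \<ge> 0" "(A *v q - b) \<bullet> l > 0"
    by blast
  \<comment> \<open>Were \<open>q\<close> feasible, each summand would be a nonpositive entry times
    a nonnegative weight, contradicting the positive total.\<close>
  have "(A *v q - b) \<bullet> l \<le> 0" if "A *v q \<le> b"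
    unfolding inner_vec_def using that l(1)
    by (intro sum_nonpos) (auto simp: less_eq_vec_def mult_nonpos_nonneg)
  with l(2) assms(1) show "{q} \<inter> C = {}"
    by auto
qed

end
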